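(* Let $X$ be a real Banach space, $n,m\in\mathbb N$, $1\le p\le q<\infty$, and $0\le\Gamma<\infty$. The following two assertions are equivalent. (i) For every $F:G_{m,n}\to X$, $$\|\mathcal D_{q,\mathrm{long}}F\|_{L_p(G_{m,n}\times[n];X)}\le\Gamma\,\|D_{\mathrm{sgn}}F\|_{L_p(G_{m,n}\times\Sigma_n;X)}.$$ (ii) Every $g\in L_{p'}(G_{m,n}\times[n];X^* )$ admits an $h\in L_{p'}(G_{m,n}\times\Sigma_n;X^* )$ such that $$D_{\mathrm{sgn}}^*h=\mathcal D_{q,\mathrm{long}}^*g,\qquad \|h\|_{L_{p'}(G_{m,n}\times\Sigma_n;X^* )}\le\Gamma\,\|g\|_{L_{p'}(G_{m,n}\times[n];X^* )}.$$ Moreover, the optimal (infimal) constants $\Gamma$ in the two assertions are equal.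
   Context: All Banach spaces are real; $\mathbb N=\{1,2,\ldots\}$; $[n]=\{1,\ldots,n\}$; $p'$ is the conjugate exponent of $p$, with $p'=\infty$ when $p=1$; $X^*$ is the Banach dual of $X$. Let $G_{m,n}=(\mathbb Z/(2m\mathbb Z))^n$ and $\Sigma_n=\{-1,1\}^n$. Let $e_j$ be the $j$-th standard basis vector; additions in $G_{m,n}$ are modulo $2m$. For a finite nonempty set $\Omega$, a Banach space $Y$ and $1\le r<\infty$, $L_r(\Omega;Y)$ is the space of all maps $F:\Omega\to Y$ with $\|F\|_{L_r(\Omega;Y)}=\bigl(|\Omega|^{-1}\sum_{\omega\in\Omega}\|F(\omega)\|_Y^r\bigr)^{1/r}$; for $r=\infty$ the norm is the maximum of $\|F(\omega)\|_Y$. For $F:G_{m,n}\to X$ define $(D_{\mathrm{long}}F)(x,j)=F(x+me_j)-F(x)$ for $(x,j)\in G_{m,n}\times[n]$ and $(D_{\mathrm{sgn}}F)(x,\varepsilon)=F(x+\varepsilon)-F(x)$ for $(x,\varepsilon)\in G_{m,n}\times\Sigma_n$. Set $\mathcal D_{q,\mathrm{long}}=\frac{n^{1/q}}{m}D_{\mathrm{long}}$. The adjoints (for the normalized finite-sum dualities) are, for $g:G_{m,n}\times[n]\to X^*$ and $h:G_{m,n}\times\Sigma_n\to X^*$, $$D_{\mathrm{long}}^*g(x)=\frac1n\sum_{j=1}^n\bigl(g(x-me_j,j)-g(x,j)\bigr),\qquad D_{\mathrm{sgn}}^*h(x)=2^{-n}\sum_{\varepsilon\in\Sigma_n}\bigl(h(x-\varepsilon,\varepsilon)-h(x,\varepsilon)\bigr),$$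 and $\mathcal D_{q,\mathrm{long}}^*=\frac{n^{1/q}}{m}D_{\mathrm{long}}^*$. The optimal constant in an assertion is the infimum of all $\Gamma\in[0,\infty)$ for which it holds, equal to $+\infty$ if there are none. *)

theory Defs
  imports "HOL-Analysis.Analysis"
begin

text \<open>
  Elements of the group \<open>(\<int>/2m\<int>)\<^sup>n\<close> are represented by their coordinatewise
  representatives in \<open>{0..<2m}\<close>, as extensional functions on \<open>{1..n}\<close>. Maps defined on
  this group are total functions whose values off the carrier are never used.
\<close>

type_synonym point = "nat \<Rightarrow> int"

definition torus :: "nat \<Rightarrow> nat \<Rightarrow> point set" where
  "torus m n = {1..n} \<rightarrow>\<^sub>E {0..<2 * int m}"

definition signs :: "nat \<Rightarrow> point set" where
  "signs n = {1..n} \<rightarrow>\<^sub>E {-1, 1}"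

text \<open>Translation of a group element by (the class modulo \<open>2m\<close> of) an integer vector.\<close>

definition shift :: "nat \<Rightarrow> nat \<Rightarrow> point \<Rightarrow> point \<Rightarrow> point" where
  "shift m n x v = (\<lambda>i\<in>{1..n}. (x i + v i) mod (2 * int m))"

definition basis_vec :: "nat \<Rightarrow> point" where
  "basis_vec j = (\<lambda>i. if i = j then 1 else 0)"

text \<open>
  The norm of \<open>L\<^sub>r(\<Omega>; Y)\<close> with respect to normalized counting measure, for finite nonempty
  \<open>\<Omega>\<close> and \<open>1 \<le> r \<le> \<infinity>\<close>.
\<close>

definition Lnorm :: "ereal \<Rightarrow> 'w set \<Rightarrow> ('w \<Rightarrow> 'y::real_normed_vector) \<Rightarrow> real" where
  "Lnorm r \<Omega> F =
     (if r = \<infinity> then Max ((\<lambda>\<omega>. norm (F \<omega>)) ` \<Omega>)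
      else ((\<Sum>\<omega>\<in>\<Omega>. norm (F \<omega>) powr real_of_ereal r) / real (card \<Omega>))
             powr (1 / real_of_ereal r))"

definition conj_exponent :: "real \<Rightarrow> ereal" where
  "conj_exponent p = (if p = 1 then \<infinity> else ereal (p / (p - 1)))"

definition D_long :: "nat \<Rightarrow> nat \<Rightarrow> (point \<Rightarrow> 'a::real_normed_vector) \<Rightarrow> point \<times> nat \<Rightarrow> 'a" where
  "D_long m n F = (\<lambda>(x, j). F (shift m n x (\<lambda>i. int m * basis_vec j i)) - F x)"

definition D_sgn :: "nat \<Rightarrow> nat \<Rightarrow> (point \<Rightarrow> 'a::real_normed_vector) \<Rightarrow> point \<times> point \<Rightarrow> 'a" where
  "D_sgn m n F = (\<lambda>(x, \<epsilon>). F (shift m n x \<epsilon>) - F x)"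

definition DD_long ::
  "real \<Rightarrow> nat \<Rightarrow> nat \<Rightarrow> (point \<Rightarrow> 'a::real_normed_vector) \<Rightarrow> point \<times> nat \<Rightarrow> 'a" where
  "DD_long q m n F = (\<lambda>z. (real n powr (1 / q) / real m) *\<^sub>R D_long m n F z)"

definition D_long_adj ::
  "nat \<Rightarrow> nat \<Rightarrow> (point \<times> nat \<Rightarrow> 'b::real_normed_vector) \<Rightarrow> point \<Rightarrow> 'b" where
  "D_long_adj m n g x =
     (1 / real n) *\<^sub>R
       (\<Sum>j\<in>{1..n}. g (shift m n x (\<lambda>i. - (int m * basis_vec j i)), j) - g (x, j))"

definition D_sgn_adj ::
  "nat \<Rightarrow> nat \<Rightarrow> (point \<times> point \<Rightarrow> 'b::real_normed_vector) \<Rightarrow> point \<Rightarrow> 'b" where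
  "D_sgn_adj m n h x =
     (1 / 2 ^ n) *\<^sub>R (\<Sum>\<epsilon>\<in>signs n. h (shift m n x (\<lambda>i. - \<epsilon> i), \<epsilon>) - h (x, \<epsilon>))"

definition DD_long_adj ::
  "real \<Rightarrow> nat \<Rightarrow> nat \<Rightarrow> (point \<times> nat \<Rightarrow> 'b::real_normed_vector) \<Rightarrow> point \<Rightarrow> 'b" where
  "DD_long_adj q m n g x = (real n powr (1 / q) / real m) *\<^sub>R D_long_adj m n g x"

definition primal_assertion ::
  "'a::banach itself \<Rightarrow> nat \<Rightarrow> nat \<Rightarrow> real \<Rightarrow> real \<Rightarrow> real \<Rightarrow> bool" where
  "primal_assertion X m n p q \<Gamma> \<longleftrightarrow>
     (\<forall>F :: point \<Rightarrow> 'a.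
        Lnorm (ereal p) (torus m n \<times> {1..n}) (DD_long q m n F)
          \<le> \<Gamma> * Lnorm (ereal p) (torus m n \<times> signs n) (D_sgn m n F))"

definition dual_assertion ::
  "'a::banach itself \<Rightarrow> nat \<Rightarrow> nat \<Rightarrow> real \<Rightarrow> real \<Rightarrow> real \<Rightarrow> bool" where
  "dual_assertion X m n p q \<Gamma> \<longleftrightarrow>
     (\<forall>g :: point \<times> nat \<Rightarrow> ('a \<Rightarrow>\<^sub>L real).
        \<exists>h :: point \<times> point \<Rightarrow> ('a \<Rightarrow>\<^sub>L real).
          (\<forall>x\<in>torus m n. D_sgn_adj m n h x = DD_long_adj q m n g x) \<and>
          Lnorm (conj_exponent p) (torus m n \<times> signs n) h
            \<le> \<Gamma> * Lnorm (conj_exponent p) (torus m n \<times> {1..n}) g)"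

text \<open>The infimum is taken in the extended reals, so it is \<open>\<infinity>\<close> if no constant is admissible.\<close>

definition optimal_constant :: "(real \<Rightarrow> bool) \<Rightarrow> ereal" where
  "optimal_constant A = Inf {ereal \<Gamma> | \<Gamma>. 0 \<le> \<Gamma> \<and> A \<Gamma>}"

end

theory Submission
  imports Defs "HOL-Library.Function_Algebras"
begin

text \<open>
  Both assertions compare the linear operators \<open>A = D_sgn\<close> and \<open>B = DD_long\<close> on the space of
  \<open>X\<close>-valued functions on the torus, and the equivalence is an instance of a general principle:
  an inequality \<open>\<parallel>B F\<parallel> \<le> \<Gamma> \<parallel>A F\<parallel>\<close> holds for all \<open>F\<close> if and only if, for every \<open>g\<close>, the equation
  \<open>A* h = B* g\<close> has a solution with \<open>\<parallel>h\<parallel> \<le> \<Gamma> \<parallel>g\<parallel>\<close>, the norms on the right being dual norms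
  (\<open>inequality_iff_dual_solvability\<close>).

  If the inequality holds, then \<open>A F \<mapsto> \<langle>B F, g\<rangle>\<close> is a well-defined functional on the range of
  \<open>A\<close>, bounded by \<open>\<Gamma> \<parallel>g\<parallel>\<close> times the \<open>L\<^sub>p\<close> norm. The Hahn--Banach theorem extends it to all
  functions on the finite set \<open>\<Omega>\<close> with the same bound, and a functional on
  \<open>L\<^sub>p(\<Omega>; X)\<close> is the pairing with some \<open>h : \<Omega> \<rightarrow> X*\<close> whose \<open>L\<^sub>p\<^sub>'\<close> norm is at most that bound
  (\<open>Lp_dual_representation\<close>). Conversely, given \<open>F\<close>, choose \<open>g\<close> with \<open>\<parallel>g\<parallel> \<le> 1\<close> and
  \<open>\<langle>B F, g\<rangle> = \<parallel>B F\<parallel>\<close> (\<open>Lnorm_attained\<close>); if \<open>A* h = B* g\<close>, then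
  \<open>\<parallel>B F\<parallel> = \<langle>A F, h\<rangle> \<le> \<parallel>A F\<parallel> \<parallel>h\<parallel> \<le> \<Gamma> \<parallel>A F\<parallel>\<close>.

  The equation \<open>A* h = B* g\<close> is understood weakly above, that is, tested against all \<open>F\<close>. Since
  translations permute the torus, summation by parts turns it into the pointwise equation between
  the explicit adjoints (\<open>pairing_D_sgn\<close>, \<open>pairing_DD_long\<close>, \<open>pairing_separates\<close>). As the two
  assertions hold for the same nonnegative \<open>\<Gamma>\<close>, their infimal constants agree.
\<close>

section \<open>The Hahn--Banach theorem\<close>

definition sublinear :: "('v::real_vector \<Rightarrow> real) \<Rightarrow> bool" where
  "sublinear S \<longleftrightarrow> (\<forall>u v. S (u + v) \<le> S u + S v) \<and> (\<forall>c\<ge>0. \<forall>u. S (c *\<^sub>R u) \<le> c * S u)"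

lemma sublinear_add: "sublinear S \<Longrightarrow> S (u + v) \<le> S u + S v"
  and sublinear_scale: "sublinear S \<Longrightarrow> 0 \<le> c \<Longrightarrow> S (c *\<^sub>R u) \<le> c * S u"
  by (auto simp: sublinear_def)

lemma sublinear_zero:
  assumes "sublinear S" shows "S 0 = 0"
  using sublinear_add[OF assms, of 0 0] sublinear_scale[OF assms, of 0 0] by simp

lemma sublinear_neg_le:
  assumes "sublinear S" shows "- S (- u) \<le> S u"
  using sublinear_add[OF assms, of u "- u"] sublinear_zero[OF assms] by simp

text \<open>
  The infimum is finite because \<open>- S (- u)\<close> is a common lower bound of all \<open>T u\<close>. Subadditivity
  survives only because \<open>C\<close> is a chain: of two members \<open>T\<close> and \<open>T'\<close> the smaller one bounds the
  infimum at \<open>u + v\<close> by \<open>T u + T' v\<close>.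
\<close>

lemma sublinear_Inf_chain:
  assumes ne: "C \<noteq> {}" and sub: "\<And>T. T \<in> C \<Longrightarrow> sublinear T" 
    and chain: "\<And>T T'. T \<in> C \<Longrightarrow> T' \<in> C \<Longrightarrow> (\<forall>u. T u \<le> T' u) \<or> (\<forall>u. T' u \<le> T u)"
    and le: "\<And>T u. T \<in> C \<Longrightarrow> T u \<le> S u"
  shows "sublinear (\<lambda>u. INF T\<in>C. T u)" and "T \<in> C \<Longrightarrow> (INF T\<in>C. T u) \<le> T u"
proof -
  have bdd: "bdd_below ((\<lambda>T. T u) ` C)" for u
  proof (rule bdd_belowI2)
    fix T assume T: "T \<in> C"
    show "- S (- u) \<le> T u" using sublinear_neg_le[OF sub[OF T], of u] le[OF T, of "- u"] by linarith
  qed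
  show lower: "(INF T\<in>C. T u) \<le> T u" if "T \<in> C" for T u
    using bdd that by (rule cINF_lower)
  have add: "(INF T\<in>C. T (u + v)) \<le> (INF T\<in>C. T u) + (INF T\<in>C. T v)" for u v
  proof -
    have *: "(INF T\<in>C. T (u + v)) \<le> T u + T' v" if T: "T \<in> C" "T' \<in> C" for T T'
      using chain[OF T]
    proof
      assume a: "\<forall>u. T u \<le> T' u"
      show ?thesis using lower[OF T(1), of "u + v"] sublinear_add[OF sub[OF T(1)], of u v] spec[OF a, of v]
        by linarith
    next
      assume a: "\<forall>u. T' u \<le> T u"
      show ?thesis using lower[OF T(2), of "u + v"] sublinear_add[OF sub[OF T(2)], of u v] spec[OF a, of u]
        by linarith
    qed
    have "(INF T\<in>C. T (u + v)) - T u \<le> (INF T\<in>C. T v)" if "T \<in> C" for T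
      using *[OF that] by (intro cINF_greatest[OF ne]) (simp add: algebra_simps)
    hence "(INF T\<in>C. T (u + v)) - (INF T\<in>C. T v) \<le> (INF T\<in>C. T u)"
      by (intro cINF_greatest[OF ne]) (simp add: algebra_simps)
    thus ?thesis by simp
  qed
  have scale: "(INF T\<in>C. T (c *\<^sub>R u)) \<le> c * (INF T\<in>C. T u)" if c: "0 \<le> c" for c u
  proof -
    have *: "(INF T\<in>C. T (c *\<^sub>R u)) \<le> c * T u" if "T \<in> C" for T
      using lower[OF that] sublinear_scale[OF sub[OF that] c] by (rule order_trans)
    show ?thesis
    proof (cases "c = 0")
      case True
      then show ?thesis using * ne by fastforce
    next
      case False
      with c have "0 < c" by simp
      hence "(INF T\<in>C. T (c *\<^sub>R u)) / c \<le> (INF T\<in>C. T u)"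
        using * by (intro cINF_greatest[OF ne]) (simp add: field_simps)
      thus ?thesis using \<open>0 < c\<close> by (simp add: field_simps)
    qed
  qed
  show "sublinear (\<lambda>u. INF T\<in>C. T u)" unfolding sublinear_def using add scale by blast
qed

lemma exists_minimal_sublinear:
  assumes S: "sublinear (S :: 'v::real_vector \<Rightarrow> real)"
  obtains T where "sublinear T" "\<And>u. T u \<le> S u"
    "\<And>T'. sublinear T' \<Longrightarrow> (\<And>u. T' u \<le> T u) \<Longrightarrow> T' = T"
proof -
  define A where "A = {T. sublinear T \<and> (\<forall>u. T u \<le> S u)}"
  define P where "P = (\<lambda>T T'. \<forall>u. T' u \<le> (T :: 'v \<Rightarrow> real) u)"
  have po: "partial_order_on A (relation_of P A)"
    unfolding partial_order_on_def preorder_on_def relation_of_def P_def refl_on_def trans_def antisym_def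
    by (auto intro!: ext antisym) (meson order_trans)
  have "\<exists>m\<in>A. \<forall>T\<in>A. P m T \<longrightarrow> T = m"
  proof (rule predicate_Zorn[OF po])
    fix C assume C: "C \<in> Chains (relation_of P A)"
    hence CA: "T \<in> A" if "T \<in> C" for T using that unfolding Chains_def relation_of_def by blast
    show "\<exists>U\<in>A. \<forall>T\<in>C. P T U"
    proof (cases "C = {}")
      case True
      then show ?thesis using S by (auto simp: A_def)
    next
      case False
      have ch: "(\<forall>u. T u \<le> T' u) \<or> (\<forall>u. T' u \<le> T u)" if "T \<in> C" "T' \<in> C" for T T'
        using C that unfolding Chains_def relation_of_def P_def by blast
      have sub: "sublinear T" and le: "T u \<le> S u" if "T \<in> C" for T u
        using CA[OF that] by (auto simp: A_def)
      have U: "sublinear (\<lambda>u. INF T\<in>C. T u)"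
        by (rule sublinear_Inf_chain(1)[of C S]) (fact False sub ch le)+
      have lower: "(INF T\<in>C. T u) \<le> T u" if "T \<in> C" for T u
        by (rule sublinear_Inf_chain(2)[of C S]) (fact False sub ch le that)+
      have "(INF T\<in>C. T u) \<le> S u" for u
      proof -
        obtain T where "T \<in> C" using False by blast
        thus ?thesis using lower le by (meson order_trans)
      qed
      hence "(\<lambda>u. INF T\<in>C. T u) \<in> A" using U by (simp add: A_def)
      moreover have "P T (\<lambda>u. INF T\<in>C. T u)" if "T \<in> C" for T
        using lower that by (simp add: P_def)
      ultimately show ?thesis by blast
    qed
  qed
  then obtain m where m: "m \<in> A" and min: "\<And>T. T \<in> A \<Longrightarrow> P m T \<Longrightarrow> T = m" by blast
  show ?thesis
  proof (rule that[of m])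
    show "sublinear m" "m u \<le> S u" for u using m by (auto simp: A_def)
    fix T' assume T': "sublinear T'" "\<And>u. T' u \<le> m u"
    have "T' \<in> A" using T' m by (auto simp: A_def intro: order_trans)
    thus "T' = m" using T'(2) by (intro min) (auto simp: P_def)
  qed
qed

text \<open>
  The witness is \<open>T u = (INF k\<in>K. S (u + A k) - \<phi> k)\<close>: the term \<open>k = 0\<close> gives \<open>T \<le> S\<close>, and the
  term \<open>k\<close> evaluated at \<open>u = - A k\<close> gives the last claim, while \<open>\<phi> \<le> S \<circ> A\<close> keeps the infimum
  finite. The cone \<open>K\<close> is a parameter because two instances are needed: a ray, which shows that
  minimal sublinear functionals are linear, and a whole space, which prescribes the values of a
  functional on a subspace.
\<close>

lemma sublinear_infimal_convolution:
  fixes A :: "'k::real_vector \<Rightarrow> 'v::real_vector"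
  assumes S: "sublinear S" and A: "linear A" and \<phi>: "linear \<phi>"
    and K0: "0 \<in> K" and Kadd: "\<And>k l. k \<in> K \<Longrightarrow> l \<in> K \<Longrightarrow> k + l \<in> K"
    and Kscale: "\<And>c k. 0 \<le> c \<Longrightarrow> k \<in> K \<Longrightarrow> c *\<^sub>R k \<in> K"
    and dom: "\<And>k. k \<in> K \<Longrightarrow> \<phi> k \<le> S (A k)"
  obtains T where "sublinear T" "\<And>u. T u \<le> S u" "\<And>k. k \<in> K \<Longrightarrow> T (- A k) \<le> - \<phi> k"
proof -
  define T where "T u = (INF k\<in>K. S (u + A k) - \<phi> k)" for u
  have ne: "K \<noteq> {}" using K0 by blast
  have "bdd_below ((\<lambda>k. S (u + A k) - \<phi> k) ` K)" for u
  proof (rule bdd_belowI2)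
    fix k assume "k \<in> K"
    thus "- S (- u) \<le> S (u + A k) - \<phi> k"
      using sublinear_add[OF S, of "u + A k" "- u"] dom[of k] by simp
  qed
  hence lower: "T u \<le> S (u + A k) - \<phi> k" if "k \<in> K" for u k
    unfolding T_def using that by (rule cINF_lower)
  have add: "T (u + v) \<le> T u + T v" for u v
  proof -
    have *: "T (u + v) \<le> (S (u + A k) - \<phi> k) + (S (v + A l) - \<phi> l)" if "k \<in> K" "l \<in> K" for k l
      using lower[OF Kadd[OF that], of "u + v"] sublinear_add[OF S, of "u + A k" "v + A l"]
      by (simp add: linear_add[OF A] linear_add[OF \<phi>] algebra_simps)
    have "T (u + v) - (S (u + A k) - \<phi> k) \<le> T v" if "k \<in> K" for k
      unfolding T_def[of v] using *[OF that] by (intro cINF_greatest[OF ne]) (simp add: algebra_simps)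
    hence "T (u + v) - T v \<le> T u"
      unfolding T_def[of u] by (intro cINF_greatest[OF ne]) (simp add: algebra_simps)
    thus ?thesis by simp
  qed
  have scale: "T (c *\<^sub>R u) \<le> c * T u" if c: "0 \<le> c" for c u
  proof -
    have *: "T (c *\<^sub>R u) \<le> c * (S (u + A k) - \<phi> k)" if "k \<in> K" for k
      using lower[OF Kscale[OF c that], of "c *\<^sub>R u"] sublinear_scale[OF S c, of "u + A k"]
      by (simp add: linear_scale[OF A] linear_scale[OF \<phi>] algebra_simps)
    show ?thesis
    proof (cases "c = 0")
      case True
      then show ?thesis using *[OF K0] by simp
    next
      case False
      with c have "0 < c" by simp
      hence "T (c *\<^sub>R u) / c \<le> T u"
        unfolding T_def[of u] using * by (intro cINF_greatest[OF ne]) (simp add: field_simps)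
      thus ?thesis using \<open>0 < c\<close> by (simp add: field_simps)
    qed
  qed
  show ?thesis
  proof (rule that)
    show "sublinear T" using add scale by (simp add: sublinear_def)
    show "T u \<le> S u" for u
      using lower[OF K0, of u] by (simp add: linear_0[OF A] linear_0[OF \<phi>])
    show "T (- A k) \<le> - \<phi> k" if "k \<in> K" for k
      using lower[OF that, of "- A k"] by (simp add: sublinear_zero[OF S])
  qed
qed

text \<open>
  A minimal sublinear functional \<open>T\<close> below \<open>S\<close> is odd: on the ray through \<open>v\<close>, the
  infimal convolution yields a sublinear functional below \<open>T\<close>, hence \<open>T\<close> itself, so
  \<open>T (- v) \<le> - T v\<close>. An odd sublinear functional is linear.
\<close>

lemma linear_below_sublinear:
  assumes S: "sublinear S"
  obtains L where "linear L" "\<And>u. L u \<le> S u"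
proof -
  obtain T where T: "sublinear T" and TS: "\<And>u. T u \<le> S u"
    and min: "\<And>T'. sublinear T' \<Longrightarrow> (\<And>u. T' u \<le> T u) \<Longrightarrow> T' = T"
    using exists_minimal_sublinear[OF S] by metis
  have neg: "T (- v) = - T v" for v
  proof (rule antisym)
    obtain T' where T': "sublinear T'" "\<And>u. T' u \<le> T u" "\<And>t. t \<in> {0..} \<Longrightarrow> T' (- (t *\<^sub>R v)) \<le> - (t * T v)"
    proof (rule sublinear_infimal_convolution[OF T, of "\<lambda>t. t *\<^sub>R v" "\<lambda>t. t * T v" "{0..}"])
      show "linear (\<lambda>t. t *\<^sub>R v)" by (simp add: linear_iff algebra_simps)
      show "linear (\<lambda>t. t * T v)" by (simp add: linear_iff algebra_simps)
      show "t * T v \<le> T (t *\<^sub>R v)" if "t \<in> {0..}" for t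
      proof (cases "t = 0")
        case False
        with that have "0 < t" by simp
        thus ?thesis using sublinear_scale[OF T, of "1 / t" "t *\<^sub>R v"] by (simp add: field_simps)
      qed (simp add: sublinear_zero[OF T])
    qed auto
    have "T' = T" using T' by (intro min)
    thus "T (- v) \<le> - T v" using T'(3)[of 1] by simp
    show "- T v \<le> T (- v)" using sublinear_neg_le[OF T, of "- v"] by simp
  qed
  have add: "T (u + v) = T u + T v" for u v
    using sublinear_add[OF T, of u v] sublinear_add[OF T, of "u + v" "- v"] neg[of v] by simp
  have pos: "T (c *\<^sub>R u) = c * T u" if "0 \<le> c" for c u
    using sublinear_scale[OF T that, of u] sublinear_scale[OF T that, of "- u"] neg[of u] neg[of "c *\<^sub>R u"]
    by simp
  have "T (c *\<^sub>R u) = c * T u" for c u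
    using pos[of c u] pos[of "- c" u] neg[of "c *\<^sub>R u"] by (cases "0 \<le> c") auto
  with add have "linear T" by (simp add: linear_iff)
  with TS show ?thesis using that by blast
qed

text \<open>
  The domain is parametrised: in place of a functional on a subspace there is a functional \<open>\<phi>\<close> on
  the parameter space \<open>'k\<close> of the range of \<open>A\<close>. The bound by \<open>S \<circ> A\<close> forces \<open>\<phi>\<close> to vanish on the
  kernel of \<open>A\<close>, so no choice of preimages is needed. A linear functional below the infimal
  convolution satisfies \<open>\<phi> \<le> L \<circ> A\<close>, and linearity turns this into an equality.
\<close>

theorem hahn_banach:
  fixes A :: "'k::real_vector \<Rightarrow> 'v::real_vector"
  assumes S: "sublinear S" and A: "linear A" and \<phi>: "linear \<phi>" and dom: "\<And>k. \<phi> k \<le> S (A k)"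
  obtains L where "linear L" "\<And>u. L u \<le> S u" "\<And>k. L (A k) = \<phi> k"
proof -
  obtain T where T: "sublinear T" "\<And>u. T u \<le> S u" "\<And>k. k \<in> UNIV \<Longrightarrow> T (- A k) \<le> - \<phi> k"
    by (rule sublinear_infimal_convolution[OF S A \<phi>, of UNIV]) (simp_all add: dom)
  obtain L where L: "linear L" "\<And>u. L u \<le> T u" using linear_below_sublinear[OF T(1)] by metis
  have ge: "\<phi> k \<le> L (A k)" for k
    using order_trans[OF L(2) T(3), OF UNIV_I, of k] by (simp add: linear_neg[OF L(1)])
  have "L (A k) = \<phi> k" for k
    using ge[of k] ge[of "- k"] by (simp add: linear_neg[OF L(1)] linear_neg[OF A] linear_neg[OF \<phi>])
  moreover have "L u \<le> S u" for u using L(2) T(2) by (rule order_trans)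
  ultimately show ?thesis using L(1) that by blast
qed

corollary norming_functional:
  fixes u :: "'a::real_normed_vector"
  obtains f :: "'a \<Rightarrow>\<^sub>L real" where "norm f \<le> 1" "f u = norm u"
proof -
  have S: "sublinear (norm :: 'a \<Rightarrow> real)" by (auto simp: sublinear_def norm_triangle_ineq)
  obtain L where L: "linear L" "\<And>v. L v \<le> norm v" "\<And>t. L (t *\<^sub>R u) = t * norm u"
  proof (rule hahn_banach[OF S, of "\<lambda>t. t *\<^sub>R u" "\<lambda>t. t * norm u"])
    show "t * norm u \<le> norm (t *\<^sub>R u)" for t by (simp add: mult_right_mono)
  qed (auto simp: linear_iff algebra_simps)
  have abs: "\<bar>L v\<bar> \<le> norm v" for v
    using L(2)[of v] L(2)[of "- v"] by (simp add: linear_neg[OF L(1)])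
  have "bounded_linear L"
    using L(1) abs by (intro bounded_linear_intro[where K = 1]) (auto simp: linear_iff)
  note app = bounded_linear_Blinfun_apply[OF this]
  show ?thesis
  proof (rule that[of "Blinfun L"])
    show "norm (Blinfun L) \<le> 1" by (rule norm_blinfun_bound) (simp_all add: app abs)
    show "Blinfun L u = norm u" using L(3)[of 1] by (simp add: app)
  qed
qed

section \<open>Norms of scalar and vector-valued functions on a finite set\<close>

definition mean :: "'w set \<Rightarrow> ('w \<Rightarrow> real) \<Rightarrow> real" where
  "mean \<Omega> a = (\<Sum>\<omega>\<in>\<Omega>. a \<omega>) / real (card \<Omega>)"

lemma mean_mono: "(\<And>\<omega>. \<omega> \<in> \<Omega> \<Longrightarrow> a \<omega> \<le> b \<omega>) \<Longrightarrow> mean \<Omega> a \<le> mean \<Omega> b"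
  unfolding mean_def by (intro divide_right_mono sum_mono) auto

lemma mean_nonneg: "(\<And>\<omega>. \<omega> \<in> \<Omega> \<Longrightarrow> 0 \<le> a \<omega>) \<Longrightarrow> 0 \<le> mean \<Omega> a"
  unfolding mean_def by (intro divide_nonneg_nonneg sum_nonneg) auto

lemma mean_cong: "(\<And>\<omega>. \<omega> \<in> \<Omega> \<Longrightarrow> a \<omega> = b \<omega>) \<Longrightarrow> mean \<Omega> a = mean \<Omega> b"
  unfolding mean_def by simp

lemma mean_add: "mean \<Omega> (\<lambda>\<omega>. a \<omega> + b \<omega>) = mean \<Omega> a + mean \<Omega> b"
  by (simp add: mean_def sum.distrib add_divide_distrib)

lemma mean_diff: "mean \<Omega> (\<lambda>\<omega>. a \<omega> - b \<omega>) = mean \<Omega> a - mean \<Omega> b"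
  by (simp add: mean_def sum_subtractf diff_divide_distrib)

lemma mean_cmult: "mean \<Omega> (\<lambda>\<omega>. c * a \<omega>) = c * mean \<Omega> a"
  by (simp add: mean_def sum_distrib_left)

lemma mean_cdivide: "mean \<Omega> (\<lambda>\<omega>. a \<omega> / c) = mean \<Omega> a / c"
  using mean_cmult[of \<Omega> "1 / c" a] by simp

lemma mean_const: "finite \<Omega> \<Longrightarrow> \<Omega> \<noteq> {} \<Longrightarrow> mean \<Omega> (\<lambda>_. c) = c"
  by (simp add: mean_def)

lemma mean_zero_imp:
  assumes "finite \<Omega>" "\<And>\<omega>. \<omega> \<in> \<Omega> \<Longrightarrow> 0 \<le> a \<omega>" "mean \<Omega> a = 0" "\<omega> \<in> \<Omega>"
  shows "a \<omega> = 0"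
proof -
  have "card \<Omega> \<noteq> 0" using assms by auto
  hence "sum a \<Omega> = 0" using assms(3) by (simp add: mean_def)
  thus ?thesis using assms sum_nonneg_eq_0_iff by blast
qed

lemma Lnorm_finite: "Lnorm (ereal r) \<Omega> F = mean \<Omega> (\<lambda>\<omega>. norm (F \<omega>) powr r) powr (1 / r)"
  by (simp add: Lnorm_def mean_def)

lemma Lnorm_infinity: "Lnorm \<infinity> \<Omega> F = Max ((\<lambda>\<omega>. norm (F \<omega>)) ` \<Omega>)"
  by (simp add: Lnorm_def)

lemma Lnorm_norm: "Lnorm r \<Omega> (\<lambda>\<omega>. norm (F \<omega>)) = Lnorm r \<Omega> F"
  by (simp add: Lnorm_def)

lemma Lnorm_nonneg:
  assumes "finite \<Omega>" "\<Omega> \<noteq> {}"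
  shows "0 \<le> Lnorm r \<Omega> F"
  using assms by (auto simp: Lnorm_def Max_ge_iff)

lemma Lnorm_mono:
  assumes fin: "finite \<Omega>" "\<Omega> \<noteq> {}" and r: "0 < r"
    and le: "\<And>\<omega>. \<omega> \<in> \<Omega> \<Longrightarrow> norm (F \<omega>) \<le> norm (G \<omega>)"
  shows "Lnorm r \<Omega> F \<le> Lnorm r \<Omega> G"
proof (cases r)
  case (real s)
  with r show ?thesis
    unfolding real Lnorm_finite
    by (auto intro!: powr_mono2 mean_mono mean_nonneg le)
next
  case PInf
  show ?thesis unfolding PInf Lnorm_infinity
  proof (rule Max.boundedI)
    fix t assume "t \<in> (\<lambda>\<omega>. norm (F \<omega>)) ` \<Omega>"
    then obtain \<omega> where "\<omega> \<in> \<Omega>" "t = norm (F \<omega>)" by blast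
    then show "t \<le> Max ((\<lambda>\<omega>. norm (G \<omega>)) ` \<Omega>)"
      using fin le by (auto intro: order_trans[OF le Max_ge])
  qed (use fin in auto)
qed (use r in auto)

lemma Lnorm_scaleR:
  assumes "0 < r"
  shows "Lnorm (ereal r) \<Omega> (\<lambda>\<omega>. c *\<^sub>R F \<omega>) = \<bar>c\<bar> * Lnorm (ereal r) \<Omega> F"
proof -
  have "Lnorm (ereal r) \<Omega> (\<lambda>\<omega>. c *\<^sub>R F \<omega>) = (\<bar>c\<bar> powr r * mean \<Omega> (\<lambda>\<omega>. norm (F \<omega>) powr r)) powr (1 / r)"
    by (simp add: Lnorm_finite powr_mult mean_cmult)
  also have "\<dots> = \<bar>c\<bar> * Lnorm (ereal r) \<Omega> F"
    using assms by (simp add: Lnorm_finite powr_mult mean_nonneg powr_powr)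
  finally show ?thesis .
qed

lemma Lnorm_const:
  assumes "finite \<Omega>" "\<Omega> \<noteq> {}" "0 < r"
  shows "Lnorm (ereal r) \<Omega> (\<lambda>_. v) = norm v"
  using assms by (simp add: Lnorm_finite mean_const powr_powr)

lemma conj_exponent_cases:
  assumes "1 \<le> p"
  obtains "p = 1" "conj_exponent p = \<infinity>"
  | s where "1 < p" "1 < s" "1 / p + 1 / s = 1" "conj_exponent p = ereal s"
proof (cases "p = 1")
  case False
  with assms have "1 < p" by simp
  moreover have "1 < p / (p - 1)" "1 / p + 1 / (p / (p - 1)) = 1"
    using \<open>1 < p\<close> by (simp_all add: field_simps)
  ultimately show ?thesis using that(2)[of "p / (p - 1)"] False unfolding conj_exponent_def by auto
qed (auto simp: conj_exponent_def that)

lemma conj_exponent_pos: "1 \<le> p \<Longrightarrow> 0 < conj_exponent p"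
  by (rule conj_exponent_cases[of p]) auto

lemma Holder_inequality:
  fixes a b :: "'w \<Rightarrow> real"
  assumes fin: "finite \<Omega>" "\<Omega> \<noteq> {}" and p: "1 \<le> p"
    and a: "\<And>\<omega>. \<omega> \<in> \<Omega> \<Longrightarrow> 0 \<le> a \<omega>" and b: "\<And>\<omega>. \<omega> \<in> \<Omega> \<Longrightarrow> 0 \<le> b \<omega>"
  shows "mean \<Omega> (\<lambda>\<omega>. a \<omega> * b \<omega>) \<le> Lnorm (ereal p) \<Omega> a * Lnorm (conj_exponent p) \<Omega> b"
  using p
proof (cases rule: conj_exponent_cases)
  case 1
  have "b \<omega> \<le> Lnorm \<infinity> \<Omega> b" if "\<omega> \<in> \<Omega>" for \<omega>
    using fin that b[OF that] unfolding Lnorm_infinity by (subst Max_ge_iff) force+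
  hence "mean \<Omega> (\<lambda>\<omega>. a \<omega> * b \<omega>) \<le> mean \<Omega> (\<lambda>\<omega>. Lnorm \<infinity> \<Omega> b * a \<omega>)"
    using a by (intro mean_mono) (simp add: mult.commute mult_left_mono)
  also have "\<dots> = Lnorm (ereal p) \<Omega> a * Lnorm (conj_exponent p) \<Omega> b"
    using 1 a by (simp add: mean_cmult Lnorm_finite mean_nonneg cong: mean_cong)
  finally show ?thesis .
next
  case (2 s)
  define \<alpha> where "\<alpha> = Lnorm (ereal p) \<Omega> a"
  define \<beta> where "\<beta> = Lnorm (ereal s) \<Omega> b"
  have pow: "mean \<Omega> (\<lambda>\<omega>. a \<omega> powr p) = \<alpha> powr p" "mean \<Omega> (\<lambda>\<omega>. b \<omega> powr s) = \<beta> powr s"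
    using 2 a b by (simp_all add: \<alpha>_def \<beta>_def Lnorm_finite powr_powr mean_nonneg cong: mean_cong)
  show ?thesis
  proof (cases "\<alpha> = 0 \<or> \<beta> = 0")
    case True
    have "a \<omega> * b \<omega> = 0" if \<omega>: "\<omega> \<in> \<Omega>" for \<omega>
    proof -
      have "a \<omega> powr p = 0 \<or> b \<omega> powr s = 0"
        using True pow mean_zero_imp[OF fin(1) _ _ \<omega>, of "\<lambda>\<omega>. a \<omega> powr p"]
          mean_zero_imp[OF fin(1) _ _ \<omega>, of "\<lambda>\<omega>. b \<omega> powr s"] by auto
      thus ?thesis by simp
    qed
    hence "mean \<Omega> (\<lambda>\<omega>. a \<omega> * b \<omega>) = mean \<Omega> (\<lambda>_. 0)" by (intro mean_cong)
    hence "mean \<Omega> (\<lambda>\<omega>. a \<omega> * b \<omega>) = 0" using fin by (simp add: mean_const)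
    thus ?thesis using fin by (simp add: Lnorm_nonneg)
  next
    case False
    hence pos: "0 < \<alpha>" "0 < \<beta>"
      using Lnorm_nonneg[OF fin] by (simp_all add: \<alpha>_def \<beta>_def less_le)
    have "mean \<Omega> (\<lambda>\<omega>. a \<omega> * b \<omega>) / (\<alpha> * \<beta>) = mean \<Omega> (\<lambda>\<omega>. (a \<omega> / \<alpha>) * (b \<omega> / \<beta>))"
      by (simp flip: mean_cdivide)
    also have "\<dots> \<le> mean \<Omega> (\<lambda>\<omega>. (a \<omega> / \<alpha>) powr p / p + (b \<omega> / \<beta>) powr s / s)"
      using 2 a b pos by (intro mean_mono Youngs_inequality) auto
    also have "\<dots> = mean \<Omega> (\<lambda>\<omega>. a \<omega> powr p / \<alpha> powr p / p + b \<omega> powr s / \<beta> powr s / s)"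
      using a b pos by (intro mean_cong) (simp add: powr_divide)
    also have "\<dots> = 1"
      using 2 pos by (simp add: mean_add mean_cdivide pow)
    finally show ?thesis using pos 2 by (simp add: \<alpha>_def \<beta>_def divide_le_eq)
  qed
qed

text \<open>
  The extremal function of Holder's inequality is \<open>a\<^sup>r\<^sup>-\<^sup>1\<close>, divided by its \<open>L\<^sub>s\<close> norm. If
  \<open>a\<close> vanishes on \<open>\<Omega>\<close>, this is a division by zero, whose value \<open>0\<close> serves as well.
\<close>

lemma norming_weight_finite:
  fixes a :: "'w \<Rightarrow> real"
  assumes fin: "finite \<Omega>" "\<Omega> \<noteq> {}" and r: "1 < r" "1 < s" "1 / r + 1 / s = 1"
    and a: "\<And>\<omega>. \<omega> \<in> \<Omega> \<Longrightarrow> 0 \<le> a \<omega>"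
  obtains b where "\<And>\<omega>. 0 \<le> b \<omega>" "Lnorm (ereal s) \<Omega> b \<le> 1"
    "mean \<Omega> (\<lambda>\<omega>. b \<omega> * a \<omega>) = Lnorm (ereal r) \<Omega> a"
proof -
  define M where "M = mean \<Omega> (\<lambda>\<omega>. a \<omega> powr r)"
  define b where "b \<omega> = a \<omega> powr (r - 1) / M powr (1 / s)" for \<omega>
  have M: "0 \<le> M" unfolding M_def by (intro mean_nonneg) auto
  have rs: "(r - 1) * s = r" using r by (simp add: field_simps)
  have "mean \<Omega> (\<lambda>\<omega>. norm (b \<omega>) powr s) = mean \<Omega> (\<lambda>\<omega>. a \<omega> powr r / M)"
    using r M by (intro mean_cong) (simp add: b_def powr_divide powr_powr rs)
  also have "\<dots> = M / M" by (simp add: mean_cdivide M_def)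
  finally have "Lnorm (ereal s) \<Omega> b = (M / M) powr (1 / s)" by (simp add: Lnorm_finite)
  hence 1: "Lnorm (ereal s) \<Omega> b \<le> 1" using r by (cases "M = 0") auto
  have "mean \<Omega> (\<lambda>\<omega>. b \<omega> * a \<omega>) = mean \<Omega> (\<lambda>\<omega>. a \<omega> powr r / M powr (1 / s))"
  proof (rule mean_cong)
    fix \<omega> assume "\<omega> \<in> \<Omega>"
    thus "b \<omega> * a \<omega> = a \<omega> powr r / M powr (1 / s)"
      using a[of \<omega>] r by (cases "a \<omega> = 0") (auto simp: b_def powr_diff)
  qed
  also have "\<dots> = M / M powr (1 / s)" by (simp add: mean_cdivide M_def)
  also have "\<dots> = M powr (1 - 1 / s)"
    using M r by (cases "M = 0") (auto simp: powr_diff)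
  also have "\<dots> = Lnorm (ereal r) \<Omega> a"
  proof -
    have "1 - 1 / s = 1 / r" using r by simp
    thus ?thesis using a by (simp add: Lnorm_finite M_def cong: mean_cong)
  qed
  finally show ?thesis using 1 by (intro that[of b]) (simp_all add: b_def)
qed

text \<open>
  At the endpoint \<open>p = 1\<close> the constant weight \<open>1\<close> is extremal.
\<close>

lemma norming_weight_conj:
  fixes a :: "'w \<Rightarrow> real"
  assumes fin: "finite \<Omega>" "\<Omega> \<noteq> {}" and p: "1 \<le> p" and a: "\<And>\<omega>. \<omega> \<in> \<Omega> \<Longrightarrow> 0 \<le> a \<omega>"
  obtains b where "\<And>\<omega>. 0 \<le> b \<omega>" "Lnorm (conj_exponent p) \<Omega> b \<le> 1"
    "mean \<Omega> (\<lambda>\<omega>. b \<omega> * a \<omega>) = Lnorm (ereal p) \<Omega> a"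
  using p
proof (cases rule: conj_exponent_cases)
  case 1
  show ?thesis
    using 1 fin a by (intro that[of "\<lambda>_. 1"])
      (simp_all add: Lnorm_infinity Lnorm_finite mean_nonneg cong: mean_cong)
next
  case (2 s)
  thus ?thesis using norming_weight_finite[OF fin, of p s a] a that by metis
qed

text \<open>
  At the endpoint \<open>p = 1\<close> the maximum of \<open>a\<close> is attained at some point, and the weight is the point
  mass there, of density \<open>card \<Omega>\<close> because the measure is normalized.
\<close>

lemma norming_weight:
  fixes a :: "'w \<Rightarrow> real"
  assumes fin: "finite \<Omega>" "\<Omega> \<noteq> {}" and p: "1 \<le> p" and a: "\<And>\<omega>. \<omega> \<in> \<Omega> \<Longrightarrow> 0 \<le> a \<omega>"
  obtains b where "\<And>\<omega>. 0 \<le> b \<omega>" "Lnorm (ereal p) \<Omega> b \<le> 1"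
    "mean \<Omega> (\<lambda>\<omega>. b \<omega> * a \<omega>) = Lnorm (conj_exponent p) \<Omega> a"
  using p
proof (cases rule: conj_exponent_cases)
  case 1
  have "Max ((\<lambda>\<omega>. norm (a \<omega>)) ` \<Omega>) \<in> (\<lambda>\<omega>. norm (a \<omega>)) ` \<Omega>" using fin by (intro Max_in) auto
  then obtain \<omega>\<^sub>0 where \<omega>\<^sub>0: "\<omega>\<^sub>0 \<in> \<Omega>" "Lnorm \<infinity> \<Omega> a = norm (a \<omega>\<^sub>0)" by (auto simp: Lnorm_infinity)
  have N: "card \<Omega> \<noteq> 0" using fin by simp
  define b where "b \<omega> = (if \<omega> = \<omega>\<^sub>0 then real (card \<Omega>) else 0)" for \<omega>
  have m: "mean \<Omega> (\<lambda>\<omega>. b \<omega> * c \<omega>) = c \<omega>\<^sub>0" for c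
    using \<omega>\<^sub>0 fin N by (simp add: mean_def b_def if_distrib if_distribR cong: if_cong)
  show ?thesis
  proof (rule that[of b])
    show "0 \<le> b \<omega>" for \<omega> by (simp add: b_def)
    then show "Lnorm (ereal p) \<Omega> b \<le> 1" using m[of "\<lambda>_. 1"] 1 by (simp add: Lnorm_finite)
    show "mean \<Omega> (\<lambda>\<omega>. b \<omega> * a \<omega>) = Lnorm (conj_exponent p) \<Omega> a"
      using m[of a] \<omega>\<^sub>0 a 1 by simp
  qed
next
  case (2 s)
  thus ?thesis using norming_weight_finite[OF fin, of s p a] a that by (metis add.commute)
qed

text \<open>
  Testing \<open>\<parallel>F + G\<parallel>\<close> against its own extremal weight reduces Minkowski's inequality to Holder's.
\<close>

lemma Lnorm_triangle:
  assumes fin: "finite \<Omega>" "\<Omega> \<noteq> {}" and p: "1 \<le> p"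
  shows "Lnorm (ereal p) \<Omega> (\<lambda>\<omega>. F \<omega> + G \<omega>) \<le> Lnorm (ereal p) \<Omega> F + Lnorm (ereal p) \<Omega> G"
proof -
  obtain b where b: "\<And>\<omega>. 0 \<le> b \<omega>" "Lnorm (conj_exponent p) \<Omega> b \<le> 1"
    "mean \<Omega> (\<lambda>\<omega>. b \<omega> * norm (F \<omega> + G \<omega>)) = Lnorm (ereal p) \<Omega> (\<lambda>\<omega>. norm (F \<omega> + G \<omega>))"
    using norming_weight_conj[OF fin p, of "\<lambda>\<omega>. norm (F \<omega> + G \<omega>)"] by auto
  have part: "mean \<Omega> (\<lambda>\<omega>. norm (H \<omega>) * b \<omega>) \<le> Lnorm (ereal p) \<Omega> H" for H :: "'a \<Rightarrow> 'b"
  proof -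
    have "mean \<Omega> (\<lambda>\<omega>. norm (H \<omega>) * b \<omega>) \<le> Lnorm (ereal p) \<Omega> H * Lnorm (conj_exponent p) \<Omega> b"
      using Holder_inequality[OF fin p, of "\<lambda>\<omega>. norm (H \<omega>)" b] b(1) by (simp add: Lnorm_norm)
    also have "\<dots> \<le> Lnorm (ereal p) \<Omega> H" 
      using b(2) Lnorm_nonneg[OF fin] by (intro mult_left_le)
    finally show ?thesis .
  qed
  have "Lnorm (ereal p) \<Omega> (\<lambda>\<omega>. F \<omega> + G \<omega>) = mean \<Omega> (\<lambda>\<omega>. b \<omega> * norm (F \<omega> + G \<omega>))"
    using b(3) by (simp add: Lnorm_norm)
  also have "\<dots> \<le> mean \<Omega> (\<lambda>\<omega>. norm (F \<omega>) * b \<omega> + norm (G \<omega>) * b \<omega>)"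
    using b(1) by (intro mean_mono) (metis norm_triangle_ineq mult_left_mono distrib_left mult.commute)
  also have "\<dots> \<le> Lnorm (ereal p) \<Omega> F + Lnorm (ereal p) \<Omega> G"
    unfolding mean_add by (intro add_mono part)
  finally show ?thesis .
qed

section \<open>Duality for vector-valued functions on a finite set\<close>

text \<open>
  The Hahn--Banach theorem is applied in the space of all functions \<open>'w \<Rightarrow> 'a\<close>, with pointwise
  operations; \<open>Lnorm\<close> is only a seminorm there, since it ignores the values off \<open>\<Omega>\<close>.
\<close>

instantiation "fun" :: (type, real_vector) real_vector
begin

definition scaleR_fun :: "real \<Rightarrow> ('a \<Rightarrow> 'b) \<Rightarrow> 'a \<Rightarrow> 'b" where
  "scaleR_fun c f = (\<lambda>x. c *\<^sub>R f x)"

instance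
  by standard (simp_all add: scaleR_fun_def fun_eq_iff algebra_simps)

end

lemma scaleR_fun_apply [simp]: "(c *\<^sub>R f) x = c *\<^sub>R f x"
  by (simp add: scaleR_fun_def)

definition pairing :: "'w set \<Rightarrow> ('w \<Rightarrow> 'a::real_normed_vector) \<Rightarrow> ('w \<Rightarrow> 'a \<Rightarrow>\<^sub>L real) \<Rightarrow> real" where
  "pairing \<Omega> u h = mean \<Omega> (\<lambda>\<omega>. h \<omega> (u \<omega>))"

lemma sublinear_Lnorm:
  assumes fin: "finite \<Omega>" "\<Omega> \<noteq> {}" and p: "1 \<le> p" and C: "0 \<le> C"
  shows "sublinear (\<lambda>u :: 'w \<Rightarrow> 'a::real_normed_vector. C * Lnorm (ereal p) \<Omega> u)"
proof -
  have "C * Lnorm (ereal p) \<Omega> (u + v) \<le> C * Lnorm (ereal p) \<Omega> u + C * Lnorm (ereal p) \<Omega> v"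
    for u v :: "'w \<Rightarrow> 'a"
    using Lnorm_triangle[OF fin p, of u v] C
    by (simp add: plus_fun_def mult_left_mono flip: distrib_left)
  moreover have "C * Lnorm (ereal p) \<Omega> (c *\<^sub>R u) = c * (C * Lnorm (ereal p) \<Omega> u)" if "0 \<le> c"
    for c and u :: "'w \<Rightarrow> 'a"
    using Lnorm_scaleR[of p \<Omega> c u] p that by (simp add: scaleR_fun_def)
  ultimately show ?thesis unfolding sublinear_def by (blast intro: eq_refl)
qed

lemma pairing_le:
  assumes fin: "finite \<Omega>" "\<Omega> \<noteq> {}" and p: "1 \<le> p"
  shows "pairing \<Omega> u h \<le> Lnorm (ereal p) \<Omega> u * Lnorm (conj_exponent p) \<Omega> h"
proof -
  have "pairing \<Omega> u h \<le> mean \<Omega> (\<lambda>\<omega>. norm (u \<omega>) * norm (h \<omega>))"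
    unfolding pairing_def
  proof (rule mean_mono)
    show "h \<omega> (u \<omega>) \<le> norm (u \<omega>) * norm (h \<omega>)" for \<omega>
      using norm_blinfun[of "h \<omega>" "u \<omega>"] by (simp add: mult.commute)
  qed
  also have "\<dots> \<le> Lnorm (ereal p) \<Omega> u * Lnorm (conj_exponent p) \<Omega> h"
    using Holder_inequality[OF fin p, of "\<lambda>\<omega>. norm (u \<omega>)" "\<lambda>\<omega>. norm (h \<omega>)"]
    by (simp add: Lnorm_norm)
  finally show ?thesis .
qed

text \<open>
  The function \<open>g\<close> is the extremal scalar weight of \<open>\<omega> \<mapsto> \<parallel>u \<omega>\<parallel>\<close> times functionals that norm
  the vectors \<open>u \<omega>\<close>; the Hahn--Banach theorem makes the latter exact.
\<close>

lemma Lnorm_attained: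
  fixes u :: "'w \<Rightarrow> 'a::real_normed_vector"
  assumes fin: "finite \<Omega>" "\<Omega> \<noteq> {}" and p: "1 \<le> p"
  obtains g where "Lnorm (conj_exponent p) \<Omega> g \<le> 1" "pairing \<Omega> u g = Lnorm (ereal p) \<Omega> u"
proof -
  obtain b where b: "\<And>\<omega>. 0 \<le> b \<omega>" "Lnorm (conj_exponent p) \<Omega> b \<le> 1"
    "mean \<Omega> (\<lambda>\<omega>. b \<omega> * norm (u \<omega>)) = Lnorm (ereal p) \<Omega> (\<lambda>\<omega>. norm (u \<omega>))"
    using norming_weight_conj[OF fin p, of "\<lambda>\<omega>. norm (u \<omega>)"] by auto
  have "\<exists>f :: 'a \<Rightarrow>\<^sub>L real. norm f \<le> 1 \<and> blinfun_apply f (u \<omega>) = norm (u \<omega>)" for \<omega>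
    by (metis norming_functional)
  then obtain f :: "'w \<Rightarrow> 'a \<Rightarrow>\<^sub>L real"
    where f: "\<And>\<omega>. norm (f \<omega>) \<le> 1" "\<And>\<omega>. f \<omega> (u \<omega>) = norm (u \<omega>)" by metis
  define g where "g \<omega> = b \<omega> *\<^sub>R f \<omega>" for \<omega>
  show ?thesis
  proof (rule that[of g])
    have "Lnorm (conj_exponent p) \<Omega> g \<le> Lnorm (conj_exponent p) \<Omega> b"
      using b(1) f(1) by (intro Lnorm_mono fin conj_exponent_pos p) (simp add: g_def mult_left_le)
    with b(2) show "Lnorm (conj_exponent p) \<Omega> g \<le> 1" by simp
    show "pairing \<Omega> u g = Lnorm (ereal p) \<Omega> u"
      using b(3) by (simp add: pairing_def g_def f(2) Lnorm_norm scaleR_blinfun.rep_eq)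
  qed
qed

lemma almost_norming_vector:
  fixes f :: "'a::real_normed_vector \<Rightarrow>\<^sub>L real"
  assumes "0 < e"
  obtains v where "norm v \<le> 1" "norm f - e \<le> f v"
proof (cases "norm f - e \<le> 0")
  case True
  then show ?thesis using that[of 0] by (simp add: blinfun.zero_right)
next
  case False
  have "\<exists>v. (norm f - e) * norm v < norm (f v)"
  proof (rule ccontr)
    assume "\<not> ?thesis"
    hence "norm f \<le> norm f - e" using False by (intro norm_blinfun_bound) (auto simp: not_less)
    thus False using assms by simp
  qed
  then obtain v where v: "(norm f - e) * norm v < \<bar>f v\<bar>" by auto
  hence v0: "v \<noteq> 0" by (auto simp: blinfun.zero_right)
  define w where "w = (sgn (f v) / norm v) *\<^sub>R v"
  have "norm f - e \<le> \<bar>f v\<bar> / norm v" using v v0 by (simp add: pos_le_divide_eq)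
  also have "\<dots> = f w"
    by (simp add: w_def blinfun.scaleR_right abs_sgn mult.commute)
  finally have "norm f - e \<le> f w" .
  moreover have "norm w \<le> 1" using v0 by (simp add: w_def abs_sgn_eq)
  ultimately show ?thesis using that by blast
qed

text \<open>
  Dually, a function \<open>h\<close> with values in \<open>X*\<close> is tested against the extremal weight of
  \<open>\<omega> \<mapsto> \<parallel>h \<omega>\<parallel>\<close> times unit-ball vectors of \<open>X\<close>. The supremum defining \<open>\<parallel>h \<omega>\<parallel>\<close> need not be
  attained, so these vectors norm \<open>h \<omega>\<close> only up to an error that is then sent to zero.
\<close>

lemma Lnorm_dual_le:
  fixes h :: "'w \<Rightarrow> 'a::real_normed_vector \<Rightarrow>\<^sub>L real"
  assumes fin: "finite \<Omega>" "\<Omega> \<noteq> {}" and p: "1 \<le> p" and C: "0 \<le> C"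
    and le: "\<And>u. pairing \<Omega> u h \<le> C * Lnorm (ereal p) \<Omega> u"
  shows "Lnorm (conj_exponent p) \<Omega> h \<le> C"
proof -
  obtain b where b: "\<And>\<omega>. 0 \<le> b \<omega>" "Lnorm (ereal p) \<Omega> b \<le> 1"
    "mean \<Omega> (\<lambda>\<omega>. b \<omega> * norm (h \<omega>)) = Lnorm (conj_exponent p) \<Omega> (\<lambda>\<omega>. norm (h \<omega>))"
    using norming_weight[OF fin p, of "\<lambda>\<omega>. norm (h \<omega>)"] by auto
  have "Lnorm (conj_exponent p) \<Omega> h \<le> C + e" if "0 < e" for e
  proof -
    \<comment> \<open>The pointwise error is averaged against the weight \<open>b\<close>, so it must be small compared to
      the mean of \<open>b\<close>; the summand \<open>1\<close> guards against a vanishing mean.\<close>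
    define d where "d = e / (1 + mean \<Omega> b)"
    have m: "0 \<le> mean \<Omega> b" using b(1) by (intro mean_nonneg)
    hence d: "0 < d" "d * mean \<Omega> b \<le> e" using that by (simp_all add: d_def field_simps)
    have "\<exists>w. norm w \<le> 1 \<and> norm (h \<omega>) - d \<le> h \<omega> w" for \<omega>
      by (rule almost_norming_vector[OF d(1), of "h \<omega>"]) blast
    then obtain v where v: "\<And>\<omega>. norm (v \<omega>) \<le> 1" "\<And>\<omega>. norm (h \<omega>) - d \<le> h \<omega> (v \<omega>)"
      by metis
    have "Lnorm (conj_exponent p) \<Omega> h - d * mean \<Omega> b = mean \<Omega> (\<lambda>\<omega>. b \<omega> * (norm (h \<omega>) - d))"
      using b(3) by (simp add: Lnorm_norm right_diff_distrib mean_diff mult.commute mean_cmult)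
    also have "\<dots> \<le> pairing \<Omega> (\<lambda>\<omega>. b \<omega> *\<^sub>R v \<omega>) h"
      unfolding pairing_def using b(1) v(2)
      by (intro mean_mono) (simp add: blinfun.scaleR_right mult_left_mono)
    also have "\<dots> \<le> C * Lnorm (ereal p) \<Omega> (\<lambda>\<omega>. b \<omega> *\<^sub>R v \<omega>)" by (rule le)
    also have "\<dots> \<le> C * Lnorm (ereal p) \<Omega> b"
      using b(1) v(1) p by (intro mult_left_mono C Lnorm_mono fin) (simp_all add: mult_left_le)
    also have "\<dots> \<le> C" using b(2) C by (intro mult_left_le)
    finally show ?thesis using d(2) by simp
  qed
  thus ?thesis by (rule field_le_epsilon)
qed

text \<open>
  A function on the finite set \<open>\<Omega>\<close> is the sum of its restrictions to single points, so \<open>L\<close> is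
  determined by its values on functions supported at one point; these define \<open>h\<close>. The factor
  \<open>card \<Omega>\<close> compensates the normalization of the pairing. Values off \<open>\<Omega>\<close> do not matter to \<open>L\<close>,
  because its bound is a seminorm that ignores them.
\<close>

lemma Lp_dual_representation:
  fixes L :: "('w \<Rightarrow> 'a::real_normed_vector) \<Rightarrow> real"
  assumes fin: "finite \<Omega>" "\<Omega> \<noteq> {}" and p: "1 \<le> p" and C: "0 \<le> C"
    and L: "linear L" and le: "\<And>u. L u \<le> C * Lnorm (ereal p) \<Omega> u"
  obtains h where "\<And>u. L u = pairing \<Omega> u h" "Lnorm (conj_exponent p) \<Omega> h \<le> C"
proof -
  have abs: "\<bar>L u\<bar> \<le> C * Lnorm (ereal p) \<Omega> u" for u
  proof -
    have "Lnorm (ereal p) \<Omega> (- u) = Lnorm (ereal p) \<Omega> u" by (simp add: Lnorm_finite)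
    thus ?thesis using le[of u] le[of "- u"] by (simp add: linear_neg[OF L] abs_le_iff)
  qed
  have N: "real (card \<Omega>) \<noteq> 0" using fin by simp
  define pt where "pt \<omega> v = (\<lambda>\<omega>'. if \<omega>' = \<omega> then v else 0)" for \<omega> :: 'w and v :: 'a
  have pt: "pt \<omega> (v + w) = pt \<omega> v + pt \<omega> w" "pt \<omega> (c *\<^sub>R v) = c *\<^sub>R pt \<omega> v" for \<omega> v w c
    by (auto simp: pt_def fun_eq_iff)
  have ptle: "\<bar>L (pt \<omega> v)\<bar> \<le> norm v * C" for \<omega> v
  proof -
    have "Lnorm (ereal p) \<Omega> (pt \<omega> v) \<le> Lnorm (ereal p) \<Omega> (\<lambda>_. v)"
      using p by (intro Lnorm_mono fin) (auto simp: pt_def)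
    also have "\<dots> = norm v" using p by (intro Lnorm_const fin) auto
    finally show ?thesis using abs[of "pt \<omega> v"] C
      by (metis mult.commute mult_left_mono order_trans)
  qed
  have bl: "bounded_linear (\<lambda>v. real (card \<Omega>) * L (pt \<omega> v))" for \<omega>
  proof (rule bounded_linear_intro)
    show "norm (real (card \<Omega>) * L (pt \<omega> v)) \<le> norm v * (C * real (card \<Omega>))" for v
      using mult_right_mono[OF ptle[of \<omega> v], of "real (card \<Omega>)"] by (simp add: abs_mult ac_simps)
  qed (simp_all add: pt linear_add[OF L] linear_scale[OF L] algebra_simps)
  define h where "h \<omega> = Blinfun (\<lambda>v. real (card \<Omega>) * L (pt \<omega> v))" for \<omega>
  have rep: "L u = pairing \<Omega> u h" for u
  proof -
    define u' where "u' = (\<Sum>\<omega>\<in>\<Omega>. pt \<omega> (u \<omega>))"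
    have sum_app: "(\<Sum>\<omega>\<in>A. pt \<omega> (u \<omega>)) x = (\<Sum>\<omega>\<in>A. pt \<omega> (u \<omega>) x)" for A x
      by (induction A rule: infinite_finite_induct) auto
    have "(u - u') \<omega> = 0" if "\<omega> \<in> \<Omega>" for \<omega>
      using that fin(1) by (simp add: u'_def sum_app) (simp add: pt_def)
    hence "Lnorm (ereal p) \<Omega> (u - u') = 0"
      using fin by (simp add: Lnorm_finite mean_const cong: mean_cong)
    hence "L u = L u'" using abs[of "u - u'"] by (simp add: linear_diff[OF L])
    also have "\<dots> = (\<Sum>\<omega>\<in>\<Omega>. L (pt \<omega> (u \<omega>)))" unfolding u'_def by (rule linear_sum[OF L])
    also have "\<dots> = pairing \<Omega> u h"
      using N by (simp add: pairing_def mean_def h_def bounded_linear_Blinfun_apply[OF bl] flip: sum_distrib_left)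
    finally show ?thesis .
  qed
  show ?thesis
  proof (rule that[OF rep])
    show "Lnorm (conj_exponent p) \<Omega> h \<le> C"
      using le unfolding rep by (intro Lnorm_dual_le fin p C)
  qed
qed

text \<open>
  The equation \<open>A* h = B* g\<close> appears in its weak form, so that no adjoint operators have to be
  constructed. For the forward direction the functional \<open>F \<mapsto> \<langle>B F, g\<rangle>\<close> is extended along \<open>A\<close> by
  the Hahn--Banach theorem; for the converse the inequality is tested with a norming \<open>g\<close>.
\<close>

theorem inequality_iff_dual_solvability:
  fixes A :: "'v::real_vector \<Rightarrow> 'w \<Rightarrow> 'a::real_normed_vector" and B :: "'v \<Rightarrow> 'z \<Rightarrow> 'a"
  assumes fin: "finite \<Omega>" "\<Omega> \<noteq> {}" and fin': "finite \<Omega>'" "\<Omega>' \<noteq> {}" and p: "1 \<le> p"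
    and A: "linear A" and B: "linear B" and \<Gamma>: "0 \<le> \<Gamma>"
  shows "(\<forall>F. Lnorm (ereal p) \<Omega>' (B F) \<le> \<Gamma> * Lnorm (ereal p) \<Omega> (A F)) \<longleftrightarrow>
    (\<forall>g. \<exists>h. (\<forall>F. pairing \<Omega> (A F) h = pairing \<Omega>' (B F) g) \<and>
      Lnorm (conj_exponent p) \<Omega> h \<le> \<Gamma> * Lnorm (conj_exponent p) \<Omega>' g)" (is "?P \<longleftrightarrow> ?D")
proof
  assume ?P
  show ?D
  proof
    fix g :: "'z \<Rightarrow> 'a \<Rightarrow>\<^sub>L real"
    define C where "C = \<Gamma> * Lnorm (conj_exponent p) \<Omega>' g"
    have C: "0 \<le> C" unfolding C_def by (intro mult_nonneg_nonneg \<Gamma> Lnorm_nonneg fin')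
    have \<phi>: "linear (\<lambda>F. pairing \<Omega>' (B F) g)"
      by (simp add: linear_iff linear_add[OF B] linear_scale[OF B] pairing_def
          blinfun.add_right blinfun.scaleR_right mean_add mean_cmult)
    have dom: "pairing \<Omega>' (B F) g \<le> C * Lnorm (ereal p) \<Omega> (A F)" for F
    proof -
      have "pairing \<Omega>' (B F) g \<le> Lnorm (ereal p) \<Omega>' (B F) * Lnorm (conj_exponent p) \<Omega>' g"
        by (rule pairing_le[OF fin' p])
      also have "\<dots> \<le> (\<Gamma> * Lnorm (ereal p) \<Omega> (A F)) * Lnorm (conj_exponent p) \<Omega>' g"
        using \<open>?P\<close> by (intro mult_right_mono Lnorm_nonneg fin') auto
      finally show ?thesis by (simp add: C_def ac_simps)
    qed
    obtain L where L: "linear L" "\<And>u. L u \<le> C * Lnorm (ereal p) \<Omega> u"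
      "\<And>F. L (A F) = pairing \<Omega>' (B F) g"
      by (rule hahn_banach[OF sublinear_Lnorm[OF fin p C] A \<phi>, OF dom]) blast
    show "\<exists>h. (\<forall>F. pairing \<Omega> (A F) h = pairing \<Omega>' (B F) g) \<and>
        Lnorm (conj_exponent p) \<Omega> h \<le> \<Gamma> * Lnorm (conj_exponent p) \<Omega>' g"
      using Lp_dual_representation[OF fin p C L(1,2)] L(3) unfolding C_def by metis
  qed
next
  assume ?D
  show ?P
  proof
    fix F
    obtain g where g: "Lnorm (conj_exponent p) \<Omega>' g \<le> 1" "pairing \<Omega>' (B F) g = Lnorm (ereal p) \<Omega>' (B F)"
      using Lnorm_attained[OF fin' p] by metis
    obtain h where h: "pairing \<Omega> (A F) h = pairing \<Omega>' (B F) g"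
      "Lnorm (conj_exponent p) \<Omega> h \<le> \<Gamma> * Lnorm (conj_exponent p) \<Omega>' g"
      using \<open>?D\<close> by blast
    have "Lnorm (conj_exponent p) \<Omega> h \<le> \<Gamma>"
      using h(2) g(1) \<Gamma> by (meson mult_left_le order_trans)
    hence "Lnorm (ereal p) \<Omega> (A F) * Lnorm (conj_exponent p) \<Omega> h \<le> Lnorm (ereal p) \<Omega> (A F) * \<Gamma>"
      by (intro mult_left_mono Lnorm_nonneg fin)
    with pairing_le[OF fin p, of "A F" h] h(1) g(2)
    show "Lnorm (ereal p) \<Omega>' (B F) \<le> \<Gamma> * Lnorm (ereal p) \<Omega> (A F)" by (simp add: mult.commute)
  qed
qed

section \<open>Difference operators on the discrete torus\<close>

lemma finite_torus: "finite (torus m n)"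
  and finite_signs: "finite (signs n)"
  by (auto simp: torus_def signs_def intro!: finite_PiE)

lemma torus_nonempty: "1 \<le> m \<Longrightarrow> torus m n \<noteq> {}"
  and signs_nonempty: "signs n \<noteq> {}"
  by (auto simp: torus_def signs_def PiE_eq_empty_iff)

lemma card_signs: "card (signs n) = 2 ^ n"
  by (simp add: signs_def card_PiE numeral_2_eq_2)

lemma shift_in_torus: "1 \<le> m \<Longrightarrow> shift m n x v \<in> torus m n"
  by (auto simp: shift_def torus_def)

lemma shift_shift_neg:
  assumes "x \<in> torus m n"
  shows "shift m n (shift m n x v) (\<lambda>i. - v i) = x" "shift m n (shift m n x (\<lambda>i. - v i)) v = x"
  using assms by (auto simp: shift_def torus_def fun_eq_iff PiE_iff extensional_def mod_simps)

text \<open>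
  Translation by \<open>v\<close> is a permutation of the torus with inverse translation by \<open>- v\<close>.
\<close>

lemma sum_torus_shift:
  assumes "1 \<le> m"
  shows "(\<Sum>x\<in>torus m n. a (shift m n x (\<lambda>i. - v i)) x) = (\<Sum>x\<in>torus m n. a x (shift m n x v))"
  using assms
  by (intro sum.reindex_bij_witness[where i = "\<lambda>x. shift m n x v" and j = "\<lambda>x. shift m n x (\<lambda>i. - v i)"])
    (auto simp: shift_in_torus shift_shift_neg)

text \<open>
  Summation by parts, for a family \<open>v\<close> of translation vectors with an arbitrary finite index set,
  which covers both difference operators: \<open>v j = m e\<^sub>j\<close> for the long differences and
  \<open>v \<epsilon> = \<epsilon>\<close> for the sign differences.
\<close>

lemma pairing_shift_difference:
  assumes m: "1 \<le> m" and J: "finite J"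
  shows "pairing (torus m n \<times> J) (\<lambda>(x, j). F (shift m n x (v j)) - F x) h =
    pairing (torus m n) F
      (\<lambda>x. (1 / real (card J)) *\<^sub>R (\<Sum>j\<in>J. h (shift m n x (\<lambda>i. - v j i), j) - h (x, j)))"
proof -
  have "(\<Sum>z\<in>torus m n \<times> J. h z ((\<lambda>(x, j). F (shift m n x (v j)) - F x) z)) =
      (\<Sum>x\<in>torus m n. \<Sum>j\<in>J. h (x, j) (F (shift m n x (v j)) - F x))"
    by (simp add: sum.cartesian_product split_def)
  also have "\<dots> = (\<Sum>j\<in>J. (\<Sum>x\<in>torus m n. h (x, j) (F (shift m n x (v j)))) - (\<Sum>x\<in>torus m n. h (x, j) (F x)))"
    by (subst sum.swap) (simp add: blinfun.diff_right sum_subtractf)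
  also have "\<dots> = (\<Sum>j\<in>J. (\<Sum>x\<in>torus m n. h (shift m n x (\<lambda>i. - v j i), j) (F x)) - (\<Sum>x\<in>torus m n. h (x, j) (F x)))"
    by (simp add: sum_torus_shift[OF m, where a = "\<lambda>y x. h (y, _) (F x)"])
  also have "\<dots> = (\<Sum>x\<in>torus m n. (\<Sum>j\<in>J. h (shift m n x (\<lambda>i. - v j i), j) - h (x, j)) (F x))"
    by (simp add: blinfun.diff_left blinfun.sum_left sum_subtractf sum.swap[of _ J])
  finally show ?thesis
    by (simp add: pairing_def mean_def card_cartesian_product scaleR_blinfun.rep_eq
        sum_divide_distrib mult.commute)
qed

lemma pairing_D_sgn:
  "1 \<le> m \<Longrightarrow> pairing (torus m n \<times> signs n) (D_sgn m n F) h = pairing (torus m n) F (D_sgn_adj m n h)"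
  using pairing_shift_difference[of m "signs n" n F "\<lambda>\<epsilon>. \<epsilon>" h]
  by (simp add: D_sgn_def D_sgn_adj_def[abs_def] finite_signs card_signs)

lemma pairing_DD_long:
  assumes "1 \<le> m"
  shows "pairing (torus m n \<times> {1..n}) (DD_long q m n F) g = pairing (torus m n) F (DD_long_adj q m n g)"
proof -
  have "pairing (torus m n \<times> {1..n}) (D_long m n F) g = pairing (torus m n) F (D_long_adj m n g)"
    using pairing_shift_difference[OF assms, of "{1..n}" n F "\<lambda>j i. int m * basis_vec j i" g]
    by (simp add: D_long_def D_long_adj_def[abs_def])
  thus ?thesis
    by (simp add: DD_long_def DD_long_adj_def pairing_def blinfun.scaleR_right
        scaleR_blinfun.rep_eq mean_cmult del: times_divide_eq_left)
qed

lemma linear_D_sgn: "linear (D_sgn m n)"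
  by (simp add: linear_iff D_sgn_def fun_eq_iff algebra_simps)

lemma linear_DD_long: "linear (DD_long q m n)"
  by (simp add: linear_iff DD_long_def D_long_def fun_eq_iff algebra_simps)

text \<open>
  Functions supported at one point separate the values of \<open>h\<close> and \<open>k\<close>; this makes the weak form of
  the adjoint equation pointwise.
\<close>

lemma pairing_separates:
  fixes h k :: "'a \<Rightarrow> 'b::real_normed_vector \<Rightarrow>\<^sub>L real"
  assumes fin: "finite \<Omega>"
  shows "(\<forall>F. pairing \<Omega> F h = pairing \<Omega> F k) \<longleftrightarrow> (\<forall>\<omega>\<in>\<Omega>. h \<omega> = k \<omega>)"
proof
  assume eq: "\<forall>F. pairing \<Omega> F h = pairing \<Omega> F k"
  show "\<forall>\<omega>\<in>\<Omega>. h \<omega> = k \<omega>"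
  proof
    fix \<omega> assume \<omega>: "\<omega> \<in> \<Omega>"
    show "h \<omega> = k \<omega>"
    proof (rule blinfun_eqI)
      fix v
      have "pairing \<Omega> (\<lambda>\<omega>'. if \<omega>' = \<omega> then v else 0) f = f \<omega> v / real (card \<Omega>)"
        for f :: "'a \<Rightarrow> 'b \<Rightarrow>\<^sub>L real"
      proof -
        have "(\<Sum>\<omega>'\<in>\<Omega>. f \<omega>' (if \<omega>' = \<omega> then v else 0)) = (\<Sum>\<omega>'\<in>\<Omega>. if \<omega>' = \<omega> then f \<omega> v else 0)"
          by (intro sum.cong) (auto simp: blinfun.zero_right)
        thus ?thesis using fin \<omega> by (simp add: pairing_def mean_def)
      qed
      moreover have "card \<Omega> \<noteq> 0" using fin \<omega> by auto
      ultimately show "h \<omega> v = k \<omega> v" using eq by (metis divide_cancel_right of_nat_eq_0_iff)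
    qed
  qed
qed (simp add: pairing_def cong: mean_cong)

theorem corollary1p2:
  fixes m n :: nat and p q :: real
  assumes "1 \<le> m" and "1 \<le> n" and "1 \<le> p" and "p \<le> q"
  shows "(\<forall>\<Gamma>::real. 0 \<le> \<Gamma> \<longrightarrow>
            (primal_assertion TYPE('a::banach) m n p q \<Gamma> \<longleftrightarrow>
             dual_assertion TYPE('a) m n p q \<Gamma>)) \<and>
         optimal_constant (primal_assertion TYPE('a) m n p q) =
         optimal_constant (dual_assertion TYPE('a) m n p q)"
proof -
  have equiv: "primal_assertion TYPE('a) m n p q \<Gamma> \<longleftrightarrow> dual_assertion TYPE('a) m n p q \<Gamma>"
    if "0 \<le> \<Gamma>" for \<Gamma>
  proof -
    have "primal_assertion TYPE('a) m n p q \<Gamma> \<longleftrightarrow>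
      (\<forall>g. \<exists>h. (\<forall>F :: point \<Rightarrow> 'a. pairing (torus m n \<times> signs n) (D_sgn m n F) h =
                pairing (torus m n \<times> {1..n}) (DD_long q m n F) g) \<and>
        Lnorm (conj_exponent p) (torus m n \<times> signs n) h
          \<le> \<Gamma> * Lnorm (conj_exponent p) (torus m n \<times> {1..n}) g)"
      unfolding primal_assertion_def using assms that
      by (intro inequality_iff_dual_solvability linear_D_sgn linear_DD_long)
        (auto simp: finite_torus finite_signs torus_nonempty signs_nonempty)
    also have "\<dots> \<longleftrightarrow> dual_assertion TYPE('a) m n p q \<Gamma>"
      unfolding dual_assertion_def pairing_D_sgn[OF assms(1)] pairing_DD_long[OF assms(1)]
        pairing_separates[OF finite_torus] ..
    finally show ?thesis .
  qed
  hence "optimal_constant (primal_assertion TYPE('a) m n p q) =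
      optimal_constant (dual_assertion TYPE('a) m n p q)"
    unfolding optimal_constant_def by (metis (no_types, lifting))
  with equiv show ?thesis by blast
qed

end
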